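(* For all integers $m,n\ge 0$, $$H_{m,n}=\sum_{\substack{m=\nu_1+\ldots+\nu_t\\ \nu_1,\ldots,\nu_t\geq 1}}\left(\prod_{i=1}^t\frac{a_{\nu_i+1}(\zeta_k-1)}{k(\nu_i+1)!}\right)\sum_{0\le l_1<\ldots<l_t\le n-1}P^{l_1}(q)^{\nu_1}\cdots P^{l_t}(q)^{\nu_t},$$ where the outer sum is over all $t\ge 0$ and all tuples $(\nu_1,\ldots,\nu_t)$ of integers with $\nu_i\ge 1$ and $\nu_1+\ldots+\nu_t=m$. When $m=0$ the formula is to be interpreted as saying $H_{0,n}=1$.
   Context: Let $k\ge 2$ be an integer and let $s_k(i)$ be the sum of the base-$k$ digits of $i$. Let $K$ be a field, $V$ a finite-dimensional $K$-vector space, $P\colon V\to V$ a $K$-linear map, $q\in V$, and $\zeta_k\in K$ with $\zeta_k^k=1$, $\zeta_k\neq 1$ (not necessarily primitive). Let $\mathbf u=(\mathbf u(n))_{n\ge 0}$ be a sequence in $V$ with $\mathbf u(0)=0$ and $\mathbf u(ki+j)=P(\mathbf u(i))+jq$ for all $i\ge 0$, $j=0,1,\ldots,k-1$. Let $\mathrm{Sym}(V)$ be the symmetric algebra of $V$; the $K$-algebra endomorphism of $\mathrm{Sym}(V)$ induced by $P$ is also denoted $P$, and $P^i$ is its $i$-th iterate. Zeroth powers equal $1$. Put $a_n=\sum_{j=0}^{k-1}j^n\zeta_k^j$ and $$F_{m,n}=\sum_{i=0}^{k^n-1}\zeta_k^{s_k(i)}\mathbf u(i)^m\in\mathrm{Sym}(V),\qquad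 m,n\ge 0.$$ The element $F_{m,n}$ is divisible by $\prod_{i=0}^{n-1}P^i(q)$ in $\mathrm{Sym}(V)$, which is a domain, and one defines $$H_{m,n}=\frac{(\zeta_k-1)^n}{k^n(n+m)!\prod_{i=0}^{n-1}P^i(q)}F_{m+n,n}\in \mathrm{Sym}^m(V),$$ where $\mathrm{Sym}^m(V)$ is the $m$-th symmetric power of $V$. *)

theory Defs
  imports "HOL-Library.Poly_Mapping" "HOL-Algebra.Algebraic_Closure_Type"
begin

text \<open>
  The symmetric algebra of a vector space \<open>V\<close> over a field \<open>K\<close> is presented without choosing a
  basis: it is the quotient of the polynomial ring \<open>K[x\<^sub>v : v \<in> V]\<close>, with one variable for every
  vector, by the ideal generated by the relations making \<open>v \<mapsto> x\<^sub>v\<close> linear. This is the tensor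
  algebra of \<open>V\<close> modulo the commutators, and it has the universal property of \<open>Sym(V)\<close>.
  A polynomial is a finitely supported map from exponent vectors \<open>'v \<Rightarrow>\<^sub>0 nat\<close> to coefficients in
  \<open>'k\<close>, and an element of the quotient is a coset.
\<close>

definition poly_var :: "'v \<Rightarrow> ('v \<Rightarrow>\<^sub>0 nat) \<Rightarrow>\<^sub>0 'k::field" where
  "poly_var v = Poly_Mapping.single (Poly_Mapping.single v 1) 1"

definition poly_const :: "'k::field \<Rightarrow> ('v \<Rightarrow>\<^sub>0 nat) \<Rightarrow>\<^sub>0 'k" where
  "poly_const c = Poly_Mapping.single 0 c"

definition sym_relations ::
  "('k::field \<Rightarrow> 'v::ab_group_add \<Rightarrow> 'v) \<Rightarrow> (('v \<Rightarrow>\<^sub>0 nat) \<Rightarrow>\<^sub>0 'k) set" where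
  "sym_relations scale =
     {poly_var (v + w) - poly_var v - poly_var w |v w. True} \<union>
     {poly_var (scale c v) - poly_const c * poly_var v |c v. True}"

definition sym_ideal ::
  "('k::field \<Rightarrow> 'v::ab_group_add \<Rightarrow> 'v) \<Rightarrow> (('v \<Rightarrow>\<^sub>0 nat) \<Rightarrow>\<^sub>0 'k) set" where
  "sym_ideal scale = genideal ring_of_type_algebra (sym_relations scale)"

definition Sym ::
  "('k::field \<Rightarrow> 'v::ab_group_add \<Rightarrow> 'v) \<Rightarrow> (('v \<Rightarrow>\<^sub>0 nat) \<Rightarrow>\<^sub>0 'k) set ring" where
  "Sym scale = ring_of_type_algebra Quot sym_ideal scale"

text \<open>The structure maps \<open>V \<rightarrow> Sym(V)\<close> and \<open>K \<rightarrow> Sym(V)\<close>.\<close>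

definition sym_vec ::
  "('k::field \<Rightarrow> 'v::ab_group_add \<Rightarrow> 'v) \<Rightarrow> 'v \<Rightarrow> (('v \<Rightarrow>\<^sub>0 nat) \<Rightarrow>\<^sub>0 'k) set" where
  "sym_vec scale v = sym_ideal scale +>\<^bsub>ring_of_type_algebra\<^esub> poly_var v"

definition sym_const ::
  "('k::field \<Rightarrow> 'v::ab_group_add \<Rightarrow> 'v) \<Rightarrow> 'k \<Rightarrow> (('v \<Rightarrow>\<^sub>0 nat) \<Rightarrow>\<^sub>0 'k) set" where
  "sym_const scale c = sym_ideal scale +>\<^bsub>ring_of_type_algebra\<^esub> poly_const c"

text \<open>The summands with \<open>j \<ge> i\<close> would vanish, since \<open>k ^ j > i\<close> for \<open>k \<ge> 2\<close>.\<close>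

definition digit_sum :: "nat \<Rightarrow> nat \<Rightarrow> nat" where
  "digit_sum k i = (\<Sum>j<i. (i div k ^ j) mod k)"

definition coeff_a :: "nat \<Rightarrow> 'k::field \<Rightarrow> nat \<Rightarrow> 'k" where
  "coeff_a k \<zeta> n = (\<Sum>j<k. of_nat j ^ n * \<zeta> ^ j)"

definition F_elem ::
  "('k::field \<Rightarrow> 'v::ab_group_add \<Rightarrow> 'v) \<Rightarrow> nat \<Rightarrow> 'k \<Rightarrow> (nat \<Rightarrow> 'v) \<Rightarrow> nat \<Rightarrow> nat
    \<Rightarrow> (('v \<Rightarrow>\<^sub>0 nat) \<Rightarrow>\<^sub>0 'k) set" where
  "F_elem scale k \<zeta> u m n =
     (\<Oplus>\<^bsub>Sym scale\<^esub>i\<in>{..<k ^ n}.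
        sym_const scale (\<zeta> ^ digit_sum k i) \<otimes>\<^bsub>Sym scale\<^esub>
        sym_vec scale (u i) [^]\<^bsub>Sym scale\<^esub> m)"

text \<open>
  The quotient in the domain \<open>Sym(V)\<close>: the unique \<open>h\<close> whose product with the denominator
  \<open>\<Prod>i<n. P\<^sup>i(q)\<close> is the scalar multiple of \<open>F\<^sub>m\<^sub>+\<^sub>n\<^sub>,\<^sub>n\<close>. It is meaningful only if \<open>k\<close>, \<open>(n + m)!\<close>
  and all \<open>P\<^sup>i(q)\<close> with \<open>i < n\<close> are nonzero. The powers \<open>P\<^sup>i\<close> are taken on \<open>V\<close>, on which the
  induced endomorphism of \<open>Sym(V)\<close> restricts to \<open>P\<close>. The factorial is cast with \<open>of_nat\<close>
  because the characteristic of \<open>K\<close> is arbitrary.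
\<close>

definition H_elem ::
  "('k::field \<Rightarrow> 'v::ab_group_add \<Rightarrow> 'v) \<Rightarrow> nat \<Rightarrow> 'k \<Rightarrow> ('v \<Rightarrow> 'v) \<Rightarrow> 'v \<Rightarrow> (nat \<Rightarrow> 'v)
    \<Rightarrow> nat \<Rightarrow> nat \<Rightarrow> (('v \<Rightarrow>\<^sub>0 nat) \<Rightarrow>\<^sub>0 'k) set" where
  "H_elem scale k \<zeta> P q u m n =
     (THE h. h \<in> carrier (Sym scale) \<and>
        (\<Otimes>\<^bsub>Sym scale\<^esub>i\<in>{..<n}. sym_vec scale ((P ^^ i) q)) \<otimes>\<^bsub>Sym scale\<^esub> h =
        sym_const scale ((\<zeta> - 1) ^ n / (of_nat k ^ n * of_nat (fact (n + m))))
          \<otimes>\<^bsub>Sym scale\<^esub> F_elem scale k \<zeta> u (m + n) n)"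

text \<open>Tuples are lists: compositions of \<open>m\<close>, and strictly increasing \<open>t\<close>-tuples below \<open>n\<close>.\<close>

definition compositions :: "nat \<Rightarrow> nat list set" where
  "compositions m = {\<nu>. (\<forall>x\<in>set \<nu>. x \<ge> 1) \<and> sum_list \<nu> = m}"

definition increasing_tuples :: "nat \<Rightarrow> nat \<Rightarrow> nat list set" where
  "increasing_tuples t n = {l. length l = t \<and> sorted_wrt (<) l \<and> (\<forall>x\<in>set l. x < n)}"

end

theory Submission
  imports Defs
begin

text \<open>
  The sum \<open>F\<^sub>m\<^sub>,\<^sub>n\<close> is governed by an exponential generating function. An index \<open>i < k ^ n\<close> with digits
  \<open>d\<^sub>l\<close> has \<open>u(i) = \<Sum>\<^sub>l d\<^sub>l P\<^sup>l(q)\<close>, and its digits are independent, so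
  \<open>\<Sum>\<^sub>m F\<^sub>m\<^sub>,\<^sub>n T\<^sup>m / m!\<close> is the product over \<open>l < n\<close> of the series
  \<open>\<Sum>\<^sub>j \<zeta>\<^sup>j exp(j P\<^sup>l(q) T) = \<Sum>\<^sub>r a\<^sub>r P\<^sup>l(q)\<^sup>r T\<^sup>r / r!\<close>. Since \<open>a\<^sub>0 = 0\<close> and \<open>a\<^sub>1 (\<zeta> - 1) = k\<close>, each
  factor is \<open>k P\<^sup>l(q) T / (\<zeta> - 1)\<close> times a series with constant term 1, whose coefficient of \<open>T\<^sup>\<nu>\<close> is
  \<open>a\<^sub>\<nu>\<^sub>+\<^sub>1 (\<zeta> - 1) P\<^sup>l(q)\<^sup>\<nu> / (k (\<nu> + 1)!)\<close>. Expanding the product of these series gives the sum over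
  compositions and increasing tuples.

  The characteristic of the field may be positive, so the factorials needed for the whole series need
  not be invertible. The coefficients are therefore compared one at a time: adding a new
  top digit gives the binomial recursion \<open>power_sum_Suc\<close> for \<open>F\<close>, adding a new largest index gives
  the recursion \<open>composition_sum_Suc\<close> for the right-hand side, and \<open>power_sum_factorization\<close>
  matches them by induction on \<open>n\<close>, dividing only by \<open>k\<close> and by divisors of \<open>(n + m)!\<close>.

  The comparison is made in a polynomial ring in commuting variables indexed by natural numbers.
  By \<open>Sym_embeds_into_polynomials\<close>, coordinates with respect to a finite basis embed \<open>Sym(V)\<close> into
  this integral domain, and nonzero vectors stay nonzero. This also gives cancellation in \<open>Sym(V)\<close>
  and hence the uniqueness of the quotient that defines \<open>H\<^sub>m\<^sub>,\<^sub>n\<close>.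
\<close>

section \<open>Substitution into polynomials\<close>

definition monom_subst :: "('v \<Rightarrow> 'r::comm_monoid_mult) \<Rightarrow> ('v \<Rightarrow>\<^sub>0 nat) \<Rightarrow> 'r" where
  "monom_subst f e = (\<Prod>v\<in>Poly_Mapping.keys e. f v ^ Poly_Mapping.lookup e v)"

definition poly_subst ::
  "('v \<Rightarrow> ('w \<Rightarrow>\<^sub>0 nat) \<Rightarrow>\<^sub>0 'k) \<Rightarrow> (('v \<Rightarrow>\<^sub>0 nat) \<Rightarrow>\<^sub>0 'k::field) \<Rightarrow> ('w \<Rightarrow>\<^sub>0 nat) \<Rightarrow>\<^sub>0 'k" where
  "poly_subst f p =
     (\<Sum>e\<in>Poly_Mapping.keys p. poly_const (Poly_Mapping.lookup p e) * monom_subst f e)"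

lemma poly_const_0: "poly_const 0 = 0"
  and poly_const_1: "poly_const 1 = 1"
  and poly_const_add: "poly_const (a + b) = poly_const a + poly_const b"
  and poly_const_mult: "poly_const (a * b) = poly_const a * poly_const b"
  by (simp_all add: poly_const_def single_add mult_single)

lemma monom_subst_superset:
  assumes "finite A" "Poly_Mapping.keys e \<subseteq> A"
  shows "monom_subst f e = (\<Prod>v\<in>A. f v ^ Poly_Mapping.lookup e v)"
  unfolding monom_subst_def
  by (rule prod.mono_neutral_left) (use assms in \<open>auto simp: in_keys_iff\<close>)

lemma monom_subst_add: "monom_subst f (d + e) = monom_subst f d * monom_subst f e"
proof -
  let ?A = "Poly_Mapping.keys d \<union> Poly_Mapping.keys e"
  have "monom_subst f (d + e) = (\<Prod>v\<in>?A. f v ^ Poly_Mapping.lookup (d + e) v)"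
    by (rule monom_subst_superset) (auto simp: keys_add)
  also have "\<dots> = (\<Prod>v\<in>?A. f v ^ Poly_Mapping.lookup d v) * (\<Prod>v\<in>?A. f v ^ Poly_Mapping.lookup e v)"
    by (simp add: lookup_add power_add prod.distrib)
  also have "\<dots> = monom_subst f d * monom_subst f e"
    by (simp add: monom_subst_superset[symmetric])
  finally show ?thesis .
qed

lemma poly_subst_add: "poly_subst f (p + r) = poly_subst f p + poly_subst f r"
  unfolding poly_subst_def
  by (rule setsum_keys_plus_distrib) (simp_all add: poly_const_0 poly_const_add distrib_right)

lemma poly_subst_0: "poly_subst f 0 = 0"
  by (simp add: poly_subst_def)

lemma poly_subst_sum: "poly_subst f (\<Sum>i\<in>A. g i) = (\<Sum>i\<in>A. poly_subst f (g i))"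
  by (induction A rule: infinite_finite_induct) (simp_all add: poly_subst_0 poly_subst_add)

lemma poly_subst_single:
  "poly_subst f (Poly_Mapping.single e a) = poly_const a * monom_subst f e"
  by (cases "a = 0") (simp_all add: poly_subst_def poly_const_0)

lemma sum_of_monomials:
  "p = (\<Sum>e\<in>Poly_Mapping.keys p. Poly_Mapping.single e (Poly_Mapping.lookup p e))"
proof (rule poly_mapping_eqI)
  fix d
  show "Poly_Mapping.lookup p d =
    Poly_Mapping.lookup (\<Sum>e\<in>Poly_Mapping.keys p. Poly_Mapping.single e (Poly_Mapping.lookup p e)) d"
    by (simp add: lookup_sum lookup_single when_def in_keys_iff)
qed

text \<open>
  Both sides are bilinear in \<open>p\<close> and \<open>r\<close>, so it suffices to multiply monomials, where the claim is
  additivity of exponents. Multiplicativity makes substitution a homomorphism of algebras.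
\<close>

lemma poly_subst_mult: "poly_subst f (p * r) = poly_subst f p * poly_subst f r"
proof -
  let ?s = "\<lambda>p e. Poly_Mapping.single e (Poly_Mapping.lookup p e)"
  have "p * r = (\<Sum>d\<in>Poly_Mapping.keys p. ?s p d) * (\<Sum>e\<in>Poly_Mapping.keys r. ?s r e)"
    using sum_of_monomials[of p] sum_of_monomials[of r] by metis
  also have "\<dots> = (\<Sum>d\<in>Poly_Mapping.keys p. \<Sum>e\<in>Poly_Mapping.keys r. ?s p d * ?s r e)"
    by (rule sum_product)
  finally have "poly_subst f (p * r) =
      (\<Sum>d\<in>Poly_Mapping.keys p. \<Sum>e\<in>Poly_Mapping.keys r. poly_subst f (?s p d * ?s r e))"
    by (simp add: poly_subst_sum)
  also have "\<dots> = (\<Sum>d\<in>Poly_Mapping.keys p. \<Sum>e\<in>Poly_Mapping.keys r.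
      (poly_const (Poly_Mapping.lookup p d) * monom_subst f d) *
      (poly_const (Poly_Mapping.lookup r e) * monom_subst f e))"
    by (simp add: mult_single poly_subst_single poly_const_mult monom_subst_add mult_ac)
  also have "\<dots> = poly_subst f p * poly_subst f r"
    unfolding poly_subst_def by (rule sum_product[symmetric])
  finally show ?thesis .
qed

lemma poly_subst_const: "poly_subst f (poly_const a) = poly_const a"
  using poly_subst_single[of f 0 a] by (simp add: poly_const_def monom_subst_def)

lemma poly_subst_1: "poly_subst f 1 = 1"
  using poly_subst_const[of f 1] by (simp add: poly_const_1)

lemma poly_subst_var: "poly_subst f (poly_var v) = f v"
  by (simp add: poly_var_def poly_subst_single monom_subst_def poly_const_1)

lemma poly_subst_diff: "poly_subst f (p - r) = poly_subst f p - poly_subst f r"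
  using poly_subst_add[of f "p - r" r] by (simp add: algebra_simps)

text \<open>
  Constants and variables generate the polynomial ring as a ring, so two ring homomorphisms can be
  compared on them alone.
\<close>

lemma poly_induct_const_var [case_names const var add mult]:
  fixes p :: "('v \<Rightarrow>\<^sub>0 nat) \<Rightarrow>\<^sub>0 'k::field"
  assumes const: "\<And>a. Q (poly_const a)" and var: "\<And>v. Q (poly_var v)"
    and add: "\<And>p r. Q p \<Longrightarrow> Q r \<Longrightarrow> Q (p + r)" and mult: "\<And>p r. Q p \<Longrightarrow> Q r \<Longrightarrow> Q (p * r)"
  shows "Q p"
proof -
  have vars: "Q (Poly_Mapping.single (Poly_Mapping.single v n) 1)" for v n
  proof (induction n)
    case 0
    then show ?case using const[of 1] by (simp add: poly_const_def)
  next
    case (Suc n)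
    have "Poly_Mapping.single (Poly_Mapping.single v (Suc n)) (1::'k) =
        poly_var v * Poly_Mapping.single (Poly_Mapping.single v n) 1"
      by (simp add: poly_var_def mult_single single_add[symmetric])
    then show ?case using mult[OF var Suc] by simp
  qed
  have monom: "Q (Poly_Mapping.single e a)" for e a
  proof (induction e arbitrary: a rule: update_induct)
    case const
    then show ?case using assms(1)[of a] by (simp add: poly_const_def)
  next
    case (update e v n)
    have "Poly_Mapping.update v n e = Poly_Mapping.single v n + e"
      using update(1) by (intro poly_mapping_eqI)
        (auto simp: lookup_update lookup_add lookup_single in_keys_iff)
    then have "Poly_Mapping.single (Poly_Mapping.update v n e) a =
        Poly_Mapping.single (Poly_Mapping.single v n) 1 * Poly_Mapping.single e a"
      by (simp add: mult_single)
    then show ?case using mult[OF vars update(3)] by simp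
  qed
  have "Q (\<Sum>e\<in>A. Poly_Mapping.single e (Poly_Mapping.lookup p e))" for A
    by (induction A rule: infinite_finite_induct)
      (use assms(1)[of 0] monom add in \<open>auto simp: poly_const_0\<close>)
  then show ?thesis using sum_of_monomials[of p] by metis
qed

section \<open>Rings given by a type\<close>

text \<open>
  The library's quotient construction works with rings as records, while cancellation and
  ring arithmetic are most convenient in type classes; the following equations move between the two.
\<close>

abbreviation "type_ring \<equiv> ring_of_type_algebra"

lemma type_ring_simps:
  "carrier type_ring = UNIV" "x \<otimes>\<^bsub>type_ring\<^esub> y = x * y" "x \<oplus>\<^bsub>type_ring\<^esub> y = x + y"
  "\<one>\<^bsub>type_ring\<^esub> = 1" "\<zero>\<^bsub>type_ring\<^esub> = 0"
  by (simp_all add: ring_of_type_algebra_def)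

lemma type_ring_pow: "(x::'r::comm_ring_1) [^]\<^bsub>type_ring\<^esub> (n::nat) = x ^ n"
proof -
  interpret R: cring "type_ring :: 'r ring" ..
  show ?thesis by (induction n) (simp_all add: type_ring_simps mult.commute)
qed

lemma type_ring_finsum:
  fixes f :: "'i \<Rightarrow> 'r::comm_ring_1"
  shows "finsum type_ring f A = sum f A"
proof -
  interpret R: ring "type_ring :: 'r ring" ..
  show ?thesis
    by (induction A rule: infinite_finite_induct) (simp_all add: type_ring_simps R.finsum_infinite)
qed

lemma type_ring_finprod:
  fixes f :: "'i \<Rightarrow> 'r::comm_ring_1"
  shows "finprod type_ring f A = prod f A"
proof -
  interpret R: cring "type_ring :: 'r ring" ..
  show ?thesis
    by (induction A rule: infinite_finite_induct) (simp_all add: type_ring_simps R.finprod_infinite)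
qed

section \<open>The symmetric algebra inside a polynomial ring\<close>

context
  fixes scale :: "'k::field \<Rightarrow> 'v::ab_group_add \<Rightarrow> 'v"
begin

lemma ideal_sym_ideal: "ideal (sym_ideal scale) type_ring"
proof -
  interpret R: ring "type_ring :: (('v \<Rightarrow>\<^sub>0 nat) \<Rightarrow>\<^sub>0 'k) ring" ..
  show ?thesis unfolding sym_ideal_def by (rule R.genideal_ideal) (simp add: type_ring_simps)
qed

lemma cring_Sym: "cring (Sym scale)"
proof -
  interpret ideal "sym_ideal scale" type_ring by (rule ideal_sym_ideal)
  show ?thesis unfolding Sym_def by (rule quotient_is_cring) auto
qed

lemma sym_ideal_0: "0 \<in> sym_ideal scale"
  and sym_ideal_add: "p \<in> sym_ideal scale \<Longrightarrow> r \<in> sym_ideal scale \<Longrightarrow> p + r \<in> sym_ideal scale"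
  and sym_ideal_mult: "p \<in> sym_ideal scale \<Longrightarrow> r * p \<in> sym_ideal scale"
proof -
  interpret I: ideal "sym_ideal scale" type_ring by (rule ideal_sym_ideal)
  show "0 \<in> sym_ideal scale" using additive_subgroup.zero_closed[OF I.is_additive_subgroup] by (simp add: type_ring_simps)
  show "p \<in> sym_ideal scale \<Longrightarrow> r \<in> sym_ideal scale \<Longrightarrow> p + r \<in> sym_ideal scale"
    using additive_subgroup.a_closed[OF I.is_additive_subgroup, of p r] by (simp add: type_ring_simps)
  show "p \<in> sym_ideal scale \<Longrightarrow> r * p \<in> sym_ideal scale"
    using I.I_l_closed[of p r] by (simp add: type_ring_simps)
qed

lemma sym_relation_add: "poly_var (v + w) - poly_var v - poly_var w \<in> sym_ideal scale"
  and sym_relation_scale: "poly_var (scale a v) - poly_const a * poly_var v \<in> sym_ideal scale"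
proof -
  interpret R: ring "type_ring :: (('v \<Rightarrow>\<^sub>0 nat) \<Rightarrow>\<^sub>0 'k) ring" ..
  have "sym_relations scale \<subseteq> sym_ideal scale"
    unfolding sym_ideal_def by (rule R.genideal_self) (simp add: type_ring_simps)
  then show "poly_var (v + w) - poly_var v - poly_var w \<in> sym_ideal scale"
    "poly_var (scale a v) - poly_const a * poly_var v \<in> sym_ideal scale"
    by (auto simp: sym_relations_def)
qed

end

text \<open>
  A basis of \<open>V\<close> makes \<open>Sym(V)\<close> a polynomial ring. Sending \<open>x\<^sub>v\<close> to the linear form \<open>y v\<close> of its
  coordinates gives a homomorphism \<open>\<phi>\<close> that kills the relations. Modulo the relations, it is
  inverted on the left by \<open>\<psi>\<close>, which sends each basis variable back to the variable of that basis
  vector, because \<open>x\<^sub>v\<close> is congruent to the combination of basis variables given by the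
  coordinates of \<open>v\<close>. So the kernel of \<open>\<phi>\<close> is exactly the ideal of relations. The variables are
  indexed by \<open>nat\<close>, not by basis vectors, because an order of the variables orders the monomials,
  and comparison of leading monomials then shows that the polynomials form an integral domain.
\<close>

theorem Sym_embeds_into_polynomials:
  fixes scale :: "'k::field \<Rightarrow> 'v::ab_group_add \<Rightarrow> 'v"
  assumes "finite_dimensional_vector_space scale B"
  obtains emb :: "(('v \<Rightarrow>\<^sub>0 nat) \<Rightarrow>\<^sub>0 'k) set \<Rightarrow> (nat \<Rightarrow>\<^sub>0 nat) \<Rightarrow>\<^sub>0 'k"
    and y :: "'v \<Rightarrow> (nat \<Rightarrow>\<^sub>0 nat) \<Rightarrow>\<^sub>0 'k"
  where "emb \<in> ring_hom (Sym scale) type_ring"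
    and "inj_on emb (carrier (Sym scale))"
    and "\<And>a. emb (sym_const scale a) = poly_const a"
    and "\<And>v. emb (sym_vec scale v) = y v"
    and "\<And>v w. y (v + w) = y v + y w"
    and "\<And>a v. y (scale a v) = poly_const a * y v"
    and "\<And>v. y v = 0 \<Longrightarrow> v = 0"
proof -
  interpret finite_dimensional_vector_space scale B by fact
  note rep = representation_add[OF independent_Basis] representation_scale[OF independent_Basis]
  have span: "v \<in> span B" for v using span_Basis by simp
  have finB: "finite B" by (rule finite_Basis)
  obtain idx :: "'v \<Rightarrow> nat" where idx_inj: "inj_on idx B"
    using finite_imp_inj_to_nat_seg[OF finB] by blast
  define y :: "'v \<Rightarrow> (nat \<Rightarrow>\<^sub>0 nat) \<Rightarrow>\<^sub>0 'k"
    where "y v = (\<Sum>b\<in>B. poly_const (representation B v b) * poly_var (idx b))" for v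
  have y_add: "y (v + w) = y v + y w" for v w
    by (simp add: y_def rep span poly_const_add distrib_right sum.distrib)
  have y_scale: "y (scale a v) = poly_const a * y v" for a v
    by (simp add: y_def rep span poly_const_mult sum_distrib_left mult.assoc)
  have expand: "(\<Sum>b\<in>B. scale (representation B v b) b) = v" for v
    using sum_representation_eq[OF independent_Basis span finB, of v] by simp
  have y_inj: "v = 0" if "y v = 0" for v
  proof -
    \<comment> \<open>The coordinate at \<open>b\<close> is the coefficient of the variable of \<open>b\<close> in \<open>y v\<close>.\<close>
    have "representation B v b = 0" if b: "b \<in> B" for b
    proof -
      have "0 = Poly_Mapping.lookup (y v) (Poly_Mapping.single (idx b) 1)"
        using \<open>y v = 0\<close> by simp
      also have "\<dots> = (\<Sum>b'\<in>B. if b' = b then representation B v b' else 0)"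
        unfolding y_def lookup_sum
        by (rule sum.cong) (use b idx_inj in \<open>auto simp: poly_const_def poly_var_def mult_single
            lookup_single when_def inj_on_eq_iff dest: arg_cong[where f = "\<lambda>e. Poly_Mapping.lookup e (idx b)"]\<close>)
      finally show ?thesis using b finB by simp
    qed
    then show ?thesis using expand[of v] by simp
  qed

  define \<phi> :: "(('v \<Rightarrow>\<^sub>0 nat) \<Rightarrow>\<^sub>0 'k) \<Rightarrow> (nat \<Rightarrow>\<^sub>0 nat) \<Rightarrow>\<^sub>0 'k" where "\<phi> = poly_subst y"
  define \<psi> :: "((nat \<Rightarrow>\<^sub>0 nat) \<Rightarrow>\<^sub>0 'k) \<Rightarrow> ('v \<Rightarrow>\<^sub>0 nat) \<Rightarrow>\<^sub>0 'k"
    where "\<psi> = poly_subst (\<lambda>i. poly_var (the_inv_into B idx i))"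
  define emb where "emb C = the_elem (\<phi> ` C)" for C
  interpret hom: ring_hom_ring type_ring type_ring \<phi>
    by (rule ring_hom_ringI2)
      (auto intro!: ring_hom_memI simp: \<phi>_def type_ring_simps poly_subst_add poly_subst_mult poly_subst_1)

  let ?I = "sym_ideal scale"
  have retract_var: "poly_var v - \<psi> (\<phi> (poly_var v)) \<in> ?I" for v
  proof -
    have "\<psi> (\<phi> (poly_var v)) = (\<Sum>b\<in>B. poly_const (representation B v b) * poly_var b)"
      unfolding \<phi>_def \<psi>_def poly_subst_var y_def poly_subst_sum
      by (rule sum.cong) (simp_all add: poly_subst_mult poly_subst_const poly_subst_var
          the_inv_into_f_f[OF idx_inj])
    moreover have linear: "poly_var (\<Sum>b\<in>A. scale (c b) b) - (\<Sum>b\<in>A. poly_const (c b) * poly_var b) \<in> ?I"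
      if "finite A" for c A
      using that
    proof induction
      case empty
      show ?case using sym_relation_scale[where scale = scale and a = 0 and v = 0] by (simp add: poly_const_0)
    next
      case (insert b A)
      let ?s = "\<Sum>b\<in>A. scale (c b) b" and ?t = "\<Sum>b\<in>A. poly_const (c b) * poly_var b"
      have "poly_var (scale (c b) b + ?s) - (poly_const (c b) * poly_var b + ?t) =
        (poly_var (scale (c b) b + ?s) - poly_var (scale (c b) b) - poly_var ?s) +
        ((poly_var (scale (c b) b) - poly_const (c b) * poly_var b) + (poly_var ?s - ?t))"
        by (simp add: algebra_simps)
      also have "\<dots> \<in> ?I"
        by (intro sym_ideal_add sym_relation_add sym_relation_scale insert.IH)
      finally show ?case using insert.hyps by simp
    qed
    ultimately show ?thesis using linear[of B "representation B v"] finB by (simp add: expand)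
  qed
  have retract: "p - \<psi> (\<phi> p) \<in> ?I" for p
  proof (induction p rule: poly_induct_const_var)
    case (const a)
    show ?case by (simp add: \<phi>_def \<psi>_def poly_subst_const sym_ideal_0)
  next
    case (var v)
    show ?case by (rule retract_var)
  next
    case (add p r)
    have "p + r - \<psi> (\<phi> (p + r)) = (p - \<psi> (\<phi> p)) + (r - \<psi> (\<phi> r))"
      by (simp add: \<phi>_def \<psi>_def poly_subst_add)
    then show ?case using add sym_ideal_add by metis
  next
    case (mult p r)
    have "p * r - \<psi> (\<phi> (p * r)) = r * (p - \<psi> (\<phi> p)) + \<psi> (\<phi> p) * (r - \<psi> (\<phi> r))"
      by (simp add: \<phi>_def \<psi>_def poly_subst_mult algebra_simps)
    then show ?case using mult sym_ideal_add sym_ideal_mult by metis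
  qed
  have kernel_iff: "p \<in> a_kernel type_ring type_ring \<phi> \<longleftrightarrow> \<phi> p = 0" for p
    unfolding a_kernel_def' type_ring_simps by blast
  have "p \<in> ?I" if "\<phi> p = 0" for p
    using retract[of p] that by (simp add: \<psi>_def poly_subst_0)
  moreover have "?I \<subseteq> a_kernel type_ring type_ring \<phi>"
    unfolding sym_ideal_def
  proof (rule hom.R.genideal_minimal[OF hom.kernel_is_ideal], rule subsetI, unfold kernel_iff)
    fix r assume "r \<in> sym_relations scale"
    then show "\<phi> r = 0"
      unfolding sym_relations_def \<phi>_def
      by (auto simp only: poly_subst_diff poly_subst_mult poly_subst_const poly_subst_var y_add y_scale
          Un_iff mem_Collect_eq add_diff_cancel_left' diff_self)
  qed
  ultimately have kernel: "a_kernel type_ring type_ring \<phi> = ?I"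
    using kernel_iff by blast

  show ?thesis
  proof
    show "emb \<in> ring_hom (Sym scale) type_ring"
      using hom.the_elem_hom unfolding emb_def[abs_def] Sym_def kernel .
    show "inj_on emb (carrier (Sym scale))"
      using hom.the_elem_inj unfolding emb_def[abs_def] Sym_def kernel by (rule inj_onI)
    have coset: "emb (?I +>\<^bsub>type_ring\<^esub> p) = \<phi> p" for p
      using hom.the_elem_simp[of p] unfolding emb_def kernel by (simp add: type_ring_simps)
    show "emb (sym_const scale a) = poly_const a" for a
      by (simp add: sym_const_def coset \<phi>_def poly_subst_const)
    show "emb (sym_vec scale v) = y v" for v
      by (simp add: sym_vec_def coset \<phi>_def poly_subst_var)
  qed (fact y_add y_scale y_inj)+
qed

lemma sym_const_closed: "sym_const scale a \<in> carrier (Sym scale)"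
  and sym_vec_closed: "sym_vec scale v \<in> carrier (Sym scale)"
proof -
  interpret ideal "sym_ideal scale" type_ring by (rule ideal_sym_ideal)
  show "sym_const scale a \<in> carrier (Sym scale)" "sym_vec scale v \<in> carrier (Sym scale)"
    unfolding sym_const_def sym_vec_def Sym_def
    by (rule ring_hom_closed[OF rcos_ring_hom], simp add: type_ring_simps)+
qed

section \<open>Digits\<close>

text \<open>
  Leading zeros do not change the digit sum, so the digits may be summed up to any sufficient
  length.
\<close>

lemma digit_sum_eq:
  assumes "k \<ge> 2" "i < k ^ n"
  shows "digit_sum k i = (\<Sum>j<n. (i div k ^ j) mod k)"
proof -
  have "i < k ^ i"
    using assms(1) less_exp[of i] power_mono[of 2 k i] by linarith
  moreover have "i < k ^ j" if "a \<le> j" "i < k ^ a" for a j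
    using power_increasing[OF that(1), of k] that(2) assms(1) by linarith
  ultimately have big: "i < k ^ j" if "j \<ge> i \<or> j \<ge> n" for j
    using that assms(2) by blast
  show ?thesis unfolding digit_sum_def
    by (rule sum.mono_neutral_cong[where S = "{..<i}" and T = "{..<n}"]) (auto simp: big)
qed

lemma digit_sum_top_digit:
  assumes "k \<ge> 2" "i < k ^ n" "j < k"
  shows "digit_sum k (i + j * k ^ n) = digit_sum k i + j"
proof -
  have "i + j * k ^ n < k ^ n + j * k ^ n" using assms(2) by simp
  also have "\<dots> = (j + 1) * k ^ n" by simp
  also have "\<dots> \<le> k * k ^ n" using assms(3) by (intro mult_right_mono) auto
  finally have "digit_sum k (i + j * k ^ n) = (\<Sum>l<Suc n. ((i + j * k ^ n) div k ^ l) mod k)"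
    using assms(1) by (intro digit_sum_eq) auto
  also have "\<dots> = (\<Sum>l<n. ((i + j * k ^ n) div k ^ l) mod k) + j"
    using assms by simp
  also have "(\<Sum>l<n. ((i + j * k ^ n) div k ^ l) mod k) = (\<Sum>l<n. (i div k ^ l) mod k)"
  proof (rule sum.cong)
    fix l assume "l \<in> {..<n}"
    then obtain d where n: "n = l + Suc d" by (auto dest: less_imp_Suc_add)
    have "(i + j * k ^ n) div k ^ l = (i + k ^ l * (k * (j * k ^ d))) div k ^ l"
      by (simp add: n power_add mult_ac)
    also have "\<dots> = i div k ^ l + k * (j * k ^ d)"
      using assms(1) by simp
    finally show "((i + j * k ^ n) div k ^ l) mod k = (i div k ^ l) mod k" by simp
  qed simp
  finally show ?thesis using digit_sum_eq[OF assms(1,2)] by simp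
qed

lemma sum_top_digit:
  fixes g :: "nat \<Rightarrow> 'a::comm_monoid_add"
  shows "(\<Sum>i<k ^ Suc n. g i) = (\<Sum>j<k. \<Sum>i<k ^ n. g (i + j * k ^ n))"
proof -
  have "(\<Sum>i<k ^ Suc n. g i) = (\<Sum>j<k. sum g {j * k ^ n..<j * k ^ n + k ^ n})"
    by (simp add: sum.nat_group)
  also have "\<dots> = (\<Sum>j<k. \<Sum>i<k ^ n. g (i + j * k ^ n))"
  proof (rule sum.cong[OF refl])
    fix j
    show "sum g {j * k ^ n..<j * k ^ n + k ^ n} = (\<Sum>i<k ^ n. g (i + j * k ^ n))"
      using sum.shift_bounds_nat_ivl[of g 0 "j * k ^ n" "k ^ n"]
      by (simp add: lessThan_atLeast0 add.commute)
  qed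
  finally show ?thesis .
qed

text \<open>
  The recursion for \<open>u\<close> removes the lowest digit, but the induction in the proof of the formula
  removes the highest one, in order to keep \<open>P\<^sup>0(q), \<dots>, P\<^sup>n\<^sup>-\<^sup>1(q)\<close> unchanged when \<open>n\<close> grows. In
  effect \<open>u(i)\<close> is linear in the digits of \<open>i\<close>, the digit at place \<open>n\<close> being weighted by \<open>P\<^sup>n(q)\<close>.
\<close>

lemma digit_recursion_top_digit:
  fixes scale :: "'k::field \<Rightarrow> 'v::ab_group_add \<Rightarrow> 'v"
  assumes "k \<ge> 2" and "Vector_Spaces.linear scale scale P" and "u 0 = 0"
    and rec: "\<And>i j. j < k \<Longrightarrow> u (k * i + j) = P (u i) + scale (of_nat j) q"
    and "i < k ^ n" "j < k"
  shows "u (i + j * k ^ n) = u i + scale (of_nat j) ((P ^^ n) q)"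
  using \<open>i < k ^ n\<close>
proof (induction n arbitrary: i)
  interpret P: Vector_Spaces.linear scale scale P by fact
  case 0
  show ?case using rec[OF \<open>j < k\<close>, of 0] 0 \<open>u 0 = 0\<close> by (simp add: P.zero)
next
  interpret P: Vector_Spaces.linear scale scale P by fact
  case (Suc n)
  define i' r where "i' = i div k" and "r = i mod k"
  have i: "i = k * i' + r" and r: "r < k"
    using \<open>k \<ge> 2\<close> by (simp_all add: i'_def r_def)
  have i': "i' < k ^ n"
    using Suc.prems unfolding i'_def by (simp add: less_mult_imp_div_less mult.commute)
  have "u (i + j * k ^ Suc n) = u (k * (i' + j * k ^ n) + r)"
    by (simp add: i algebra_simps)
  also have "\<dots> = P (u i') + scale (of_nat j) (P ((P ^^ n) q)) + scale (of_nat r) q"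
    using rec[OF r] Suc.IH[OF i'] by (simp add: P.add P.scale)
  also have "\<dots> = u i + scale (of_nat j) ((P ^^ Suc n) q)"
    using rec[OF r, of i'] by (simp add: i)
  finally show ?case .
qed

section \<open>The coefficients\<close>

lemma coeff_a_0:
  fixes \<zeta> :: "'k::field"
  assumes "\<zeta> ^ k = 1" "\<zeta> \<noteq> 1"
  shows "coeff_a k \<zeta> 0 = 0"
  using geometric_sum[of \<zeta> k] assms by (simp add: coeff_a_def)

text \<open>
  Multiplication by \<open>\<zeta> - 1\<close> turns \<open>\<Sum>\<^sub>j j \<zeta>\<^sup>j\<close> into a telescoping sum with value \<open>k \<zeta>\<^sup>k\<close>, up to a
  multiple of the vanishing geometric sum.
\<close>

lemma coeff_a_1:
  fixes \<zeta> :: "'k::field"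
  assumes "\<zeta> ^ k = 1" "\<zeta> \<noteq> 1"
  shows "coeff_a k \<zeta> 1 * (\<zeta> - 1) = of_nat k"
proof -
  have "coeff_a k \<zeta> 1 * (\<zeta> - 1) =
      (\<Sum>j<k. of_nat (Suc j) * \<zeta> ^ Suc j - of_nat j * \<zeta> ^ j) - \<zeta> * (\<Sum>j<k. \<zeta> ^ j)"
    unfolding coeff_a_def sum_distrib_left sum_distrib_right sum_subtractf[symmetric]
    by (rule sum.cong) (simp_all add: algebra_simps)
  also have "(\<Sum>j<k. of_nat (Suc j) * \<zeta> ^ Suc j - of_nat j * \<zeta> ^ j) = of_nat k * \<zeta> ^ k"
    using sum_lessThan_telescope[of "\<lambda>j. of_nat j * \<zeta> ^ j" k] by simp
  finally show ?thesis using coeff_a_0[OF assms] assms(1) by (simp add: coeff_a_def)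
qed

lemma of_nat_fact_nonzero_mono:
  assumes "of_nat (fact b) \<noteq> (0::'k::field)" "a \<le> b"
  shows "of_nat (fact a) \<noteq> (0::'k)"
proof -
  have "(fact a :: nat) dvd fact b" by (rule fact_dvd[OF assms(2)])
  then obtain d where d: "(fact b :: nat) = fact a * d" by (rule dvdE)
  have "(of_nat (fact b) :: 'k) = of_nat (fact a) * of_nat d"
    unfolding d by (rule of_nat_mult)
  then show ?thesis using assms(1) by auto
qed

section \<open>Sums over compositions and increasing tuples\<close>

lemma finite_compositions: "finite (compositions m)"
proof (rule finite_subset)
  show "compositions m \<subseteq> {xs. set xs \<subseteq> {..m} \<and> length xs \<le> m}"
  proof
    fix \<nu> assume "\<nu> \<in> compositions m"
    then have pos: "\<forall>x\<in>set \<nu>. x \<ge> 1" and s: "sum_list \<nu> = m" by (auto simp: compositions_def)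
    have "length \<nu> \<le> sum_list \<nu>" using pos by (induction \<nu>) auto
    then show "\<nu> \<in> {xs. set xs \<subseteq> {..m} \<and> length xs \<le> m}"
      using s member_le_sum_list[of _ \<nu>] by auto
  qed
qed (rule finite_lists_length_le, simp)

lemma finite_increasing_tuples: "finite (increasing_tuples t n)"
  by (rule finite_subset[OF _ finite_lists_length_eq[of "{..<n}" t]])
    (auto simp: increasing_tuples_def)

definition composition_pairs :: "nat \<Rightarrow> nat \<Rightarrow> (nat list \<times> nat list) set" where
  "composition_pairs m n = (SIGMA \<nu>:compositions m. increasing_tuples (length \<nu>) n)"

definition pair_weight :: "(nat \<Rightarrow> nat \<Rightarrow> 'r::comm_monoid_mult) \<Rightarrow> nat list \<times> nat list \<Rightarrow> 'r" where
  "pair_weight g = (\<lambda>(\<nu>, l). \<Prod>i<length \<nu>. g (\<nu> ! i) (l ! i))"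

lemma finite_composition_pairs: "finite (composition_pairs m n)"
  by (simp add: composition_pairs_def finite_compositions finite_increasing_tuples)

lemma composition_pairs_0: "composition_pairs m 0 = (if m = 0 then {([], [])} else {})"
  by (auto simp: composition_pairs_def compositions_def increasing_tuples_def)

lemma composition_pairs_length: "(\<nu>, l) \<in> composition_pairs m n \<Longrightarrow> length l = length \<nu>"
  by (auto simp: composition_pairs_def increasing_tuples_def)

text \<open>
  The tuples below \<open>Suc n\<close> either avoid \<open>n\<close> or, being increasing, end in \<open>n\<close>; in the second case the
  last part \<open>v\<close> of the composition belongs to \<open>n\<close> and is split off with it.
\<close>

lemma composition_pairs_Suc:
  "composition_pairs m (Suc n) = composition_pairs m n \<union>
     (\<lambda>(v, \<nu>, l). (\<nu> @ [v], l @ [n])) ` (SIGMA v:{1..m}. composition_pairs (m - v) n)"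
    (is "?L = ?A \<union> ?ext ` ?S")
proof (intro equalityI subsetI)
  fix z assume "z \<in> ?L"
  then obtain \<nu> l where z: "z = (\<nu>, l)" and \<nu>: "\<forall>x\<in>set \<nu>. x \<ge> 1" "sum_list \<nu> = m"
    and l: "length l = length \<nu>" "sorted_wrt (<) l" "\<forall>x\<in>set l. x < Suc n"
    by (auto simp: composition_pairs_def compositions_def increasing_tuples_def)
  show "z \<in> ?A \<union> ?ext ` ?S"
  proof (cases "n \<in> set l")
    case False
    then have "\<forall>x\<in>set l. x < n" using l(3) less_antisym by blast
    then show ?thesis using z \<nu> l
      by (auto simp: composition_pairs_def compositions_def increasing_tuples_def)
  next
    case True
    then have "l \<noteq> []" by auto
    then obtain l' x where l': "l = l' @ [x]" by (metis rev_exhaust)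
    then obtain \<nu>' v where \<nu>': "\<nu> = \<nu>' @ [v]" using l(1) by (cases \<nu> rule: rev_exhaust) auto
    have "x = n" "\<forall>a\<in>set l'. a < n"
      using True l l' by (auto simp: sorted_wrt_append less_Suc_eq)
    then have "z = ?ext (v, \<nu>', l')" "(v, \<nu>', l') \<in> ?S"
      using z l l' \<nu> \<nu>'
      by (auto simp: composition_pairs_def compositions_def increasing_tuples_def sorted_wrt_append)
    then show ?thesis by blast
  qed
next
  fix z assume "z \<in> ?A \<union> ?ext ` ?S"
  then show "z \<in> ?L"
    by (auto simp: composition_pairs_def compositions_def increasing_tuples_def sorted_wrt_append
        less_Suc_eq)
qed

text \<open>
  This is the coefficient of \<open>T\<^sup>m\<close> in \<open>\<Prod>\<^sub>l (1 + \<Sum>\<^sub>v g v l T\<^sup>v)\<close> with \<open>l < n\<close> and \<open>v \<ge> 1\<close>: the tuple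
  records the factors that do not contribute 1, and the composition their exponents.
\<close>

definition composition_sum :: "(nat \<Rightarrow> nat \<Rightarrow> 'r::comm_semiring_1) \<Rightarrow> nat \<Rightarrow> nat \<Rightarrow> 'r" where
  "composition_sum g m n = (\<Sum>z\<in>composition_pairs m n. pair_weight g z)"

lemma composition_sum_0: "composition_sum g m 0 = (if m = 0 then 1 else 0)"
  by (simp add: composition_sum_def composition_pairs_0 pair_weight_def)

lemma composition_sum_Suc:
  "composition_sum g m (Suc n) =
     composition_sum g m n + (\<Sum>v=1..m. g v n * composition_sum g (m - v) n)"
proof -
  let ?ext = "\<lambda>(v, \<nu>, l). (\<nu> @ [v], l @ [n])"
  let ?S = "SIGMA v:{1..m}. composition_pairs (m - v) n"
  have disj: "composition_pairs m n \<inter> ?ext ` ?S = {}"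
    by (auto simp: composition_pairs_def increasing_tuples_def)
  have "composition_sum g m (Suc n) =
      composition_sum g m n + (\<Sum>z\<in>?ext ` ?S. pair_weight g z)"
    unfolding composition_sum_def composition_pairs_Suc
    by (rule sum.union_disjoint) (use disj finite_composition_pairs in auto)
  also have "(\<Sum>z\<in>?ext ` ?S. pair_weight g z) = (\<Sum>z\<in>?S. pair_weight g (?ext z))"
    by (subst sum.reindex) (auto simp: inj_on_def)
  also have "\<dots> = (\<Sum>(v, z)\<in>?S. g v n * pair_weight g z)"
    by (rule sum.cong)
      (auto simp: pair_weight_def nth_append mult.commute dest!: composition_pairs_length)
  also have "\<dots> = (\<Sum>v=1..m. g v n * composition_sum g (m - v) n)"
    by (simp add: sum.Sigma[symmetric] finite_composition_pairs composition_sum_def sum_distrib_left)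
  finally show ?thesis .
qed

lemma composition_sum_iterated:
  "composition_sum g m n =
    (\<Sum>\<nu>\<in>compositions m. \<Sum>l\<in>increasing_tuples (length \<nu>) n. \<Prod>i<length \<nu>. g (\<nu> ! i) (l ! i))"
  unfolding composition_sum_def composition_pairs_def pair_weight_def
  by (simp add: sum.Sigma finite_compositions finite_increasing_tuples)

section \<open>Power sums over digit expansions\<close>

locale coefficient_hom =
  fixes c :: "'k::field \<Rightarrow> 'r::comm_ring_1"
  assumes c_add: "c (a + b) = c a + c b" and c_mult: "c (a * b) = c a * c b" and c_1: "c 1 = 1"
begin

lemma c_0: "c 0 = 0"
  using c_add[of 0 0] by simp

lemma c_sum: "c (\<Sum>i\<in>A. f i) = (\<Sum>i\<in>A. c (f i))"
  by (induction A rule: infinite_finite_induct) (simp_all add: c_0 c_add)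

lemma c_prod: "c (\<Prod>i\<in>A. f i) = (\<Prod>i\<in>A. c (f i))"
  by (induction A rule: infinite_finite_induct) (simp_all add: c_1 c_mult)

lemma c_power: "c (a ^ n) = c a ^ n"
  by (induction n) (simp_all add: c_1 c_mult)

lemma c_of_nat: "c (of_nat n) = of_nat n"
  by (induction n) (simp_all add: c_0 c_1 c_add)

end

text \<open>
  The image of \<open>u\<close> in the polynomial ring, reduced to what the computation uses: \<open>x l\<close> stands for
  the image of \<open>P\<^sup>l(q)\<close>, and \<open>w i\<close> for that of \<open>u(i)\<close>.
\<close>

locale digit_sequence = coefficient_hom c
  for c :: "'k::field \<Rightarrow> 'r::comm_ring_1" +
  fixes k :: nat and \<zeta> :: 'k and w x :: "nat \<Rightarrow> 'r"
  assumes k: "k \<ge> 2" and root: "\<zeta> ^ k = 1" "\<zeta> \<noteq> 1" and k_nonzero: "of_nat k \<noteq> (0::'k)"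
    and w_0: "w 0 = 0"
    and w_top_digit: "i < k ^ n \<Longrightarrow> j < k \<Longrightarrow> w (i + j * k ^ n) = w i + of_nat j * x n"
begin

definition power_sum :: "nat \<Rightarrow> nat \<Rightarrow> 'r" where
  "power_sum m n = (\<Sum>i<k ^ n. c (\<zeta> ^ digit_sum k i) * w i ^ m)"

lemma power_sum_0: "power_sum m 0 = (if m = 0 then 1 else 0)"
  by (simp add: power_sum_def digit_sum_def w_0 c_1 power_0_left)

text \<open>
  Splitting off the top digit \<open>j\<close> turns \<open>w i\<close> into \<open>w i + j x\<^sub>n\<close> and contributes a factor \<open>\<zeta>\<^sup>j\<close>.
  After binomial expansion, the sum over \<open>j\<close> in the term with \<open>x\<^sub>n\<^sup>r\<close> is \<open>a\<^sub>r\<close>.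
\<close>

lemma power_sum_Suc:
  "power_sum m (Suc n) =
    (\<Sum>r\<le>m. of_nat (m choose r) * c (coeff_a k \<zeta> r) * x n ^ r * power_sum (m - r) n)"
proof -
  let ?t = "\<lambda>r j i. of_nat (m choose r) * c (of_nat j ^ r * \<zeta> ^ j) * x n ^ r *
      (c (\<zeta> ^ digit_sum k i) * w i ^ (m - r))"
  have "power_sum m (Suc n) =
      (\<Sum>j<k. \<Sum>i<k ^ n. c (\<zeta> ^ digit_sum k (i + j * k ^ n)) * w (i + j * k ^ n) ^ m)"
    unfolding power_sum_def by (rule sum_top_digit)
  also have "\<dots> = (\<Sum>j<k. \<Sum>i<k ^ n. \<Sum>r\<le>m. ?t r j i)"
  proof (intro sum.cong refl)
    fix j i assume "j \<in> {..<k}" "i \<in> {..<k ^ n}"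
    then have "c (\<zeta> ^ digit_sum k (i + j * k ^ n)) * w (i + j * k ^ n) ^ m =
        c (\<zeta> ^ digit_sum k i) * c (\<zeta> ^ j) * (of_nat j * x n + w i) ^ m"
      using k by (simp add: digit_sum_top_digit w_top_digit power_add c_mult add.commute)
    also have "\<dots> = (\<Sum>r\<le>m. ?t r j i)"
      unfolding binomial_ring sum_distrib_left
      by (rule sum.cong) (simp_all add: c_mult c_power c_of_nat power_mult_distrib mult_ac)
    finally show "c (\<zeta> ^ digit_sum k (i + j * k ^ n)) * w (i + j * k ^ n) ^ m = (\<Sum>r\<le>m. ?t r j i)" .
  qed
  also have "\<dots> = (\<Sum>j<k. \<Sum>r\<le>m. \<Sum>i<k ^ n. ?t r j i)"
    by (intro sum.cong refl sum.swap)
  also have "\<dots> = (\<Sum>r\<le>m. \<Sum>j<k. \<Sum>i<k ^ n. ?t r j i)"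
    by (rule sum.swap)
  also have "\<dots> = (\<Sum>r\<le>m. of_nat (m choose r) * c (coeff_a k \<zeta> r) * x n ^ r * power_sum (m - r) n)"
  proof (rule sum.cong[OF refl])
    fix r
    have "(\<Sum>j<k. of_nat (m choose r) * c (of_nat j ^ r * \<zeta> ^ j) * x n ^ r) =
        of_nat (m choose r) * c (coeff_a k \<zeta> r) * x n ^ r"
      by (simp add: coeff_a_def c_sum sum_distrib_left sum_distrib_right)
    then show "(\<Sum>j<k. \<Sum>i<k ^ n. ?t r j i) =
        of_nat (m choose r) * c (coeff_a k \<zeta> r) * x n ^ r * power_sum (m - r) n"
      unfolding power_sum_def by (simp only: sum_product[symmetric])
  qed
  finally show ?thesis .
qed

text \<open>
  Since \<open>a\<^sub>0 = 0\<close>, every digit place uses up at least one degree.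
\<close>

lemma power_sum_eq_0: "m < n \<Longrightarrow> power_sum m n = 0"
proof (induction n arbitrary: m)
  case (Suc n)
  show ?case
    unfolding power_sum_Suc
  proof (intro sum.neutral ballI)
    fix r
    show "of_nat (m choose r) * c (coeff_a k \<zeta> r) * x n ^ r * power_sum (m - r) n = 0"
      using Suc.prems Suc.IH[of "m - r"] by (cases "r = 0 \<or> r > m") (auto simp: coeff_a_0[OF root] c_0 binomial_eq_0)
  qed
qed simp

definition part_coeff :: "nat \<Rightarrow> 'k" where
  "part_coeff v = coeff_a k \<zeta> (v + 1) * (\<zeta> - 1) / (of_nat k * of_nat (fact (v + 1)))"

lemma part_coeff_0: "part_coeff 0 = 1"
  using coeff_a_1[OF root] k_nonzero by (simp add: part_coeff_def)

text \<open>
  This is the asserted formula with all denominators of \<open>H\<^sub>m\<^sub>,\<^sub>n\<close> cleared. In the recursion for the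
  power sum only the terms with \<open>1 \<le> r \<le> m + 1\<close> survive. With \<open>r = v + 1\<close>, one factor \<open>x\<^sub>n\<close> goes into
  the product, the factorials combine to \<open>(n + m + 1)! / (v + 1)!\<close>, and what remains is the recursion
  for the composition sum, in which \<open>v = 0\<close> accounts for the tuples that avoid \<open>n\<close>.
\<close>

theorem power_sum_factorization:
  assumes "of_nat (fact (n + m)) \<noteq> (0::'k)"
  shows "c ((\<zeta> - 1) ^ n) * power_sum (m + n) n =
    c (of_nat k ^ n * of_nat (fact (n + m))) * (\<Prod>l<n. x l) *
    composition_sum (\<lambda>v l. c (part_coeff v) * x l ^ v) m n"
  using assms
proof (induction n arbitrary: m)
  case 0
  then show ?case by (simp add: power_sum_0 composition_sum_0 c_1)
next
  case (Suc n)
  let ?M = "m + Suc n"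
  let ?E = "composition_sum (\<lambda>v l. c (part_coeff v) * x l ^ v)"
  let ?T = "\<lambda>r. of_nat (?M choose r) * c (coeff_a k \<zeta> r) * x n ^ r * power_sum (?M - r) n"
  have "power_sum ?M (Suc n) = (\<Sum>r\<in>Suc ` {..m}. ?T r)"
    unfolding power_sum_Suc
  proof (rule sum.mono_neutral_right)
    show "\<forall>r\<in>{..?M} - Suc ` {..m}. ?T r = 0"
    proof
      fix r assume r: "r \<in> {..?M} - Suc ` {..m}"
      then have "r = 0 \<or> r > Suc m" by (cases r) auto
      then show "?T r = 0"
        using r by (auto simp: coeff_a_0[OF root] c_0 power_sum_eq_0)
    qed
  qed auto
  also have "\<dots> = (\<Sum>v\<le>m. ?T (Suc v))"
    by (simp add: sum.reindex)
  finally have "c ((\<zeta> - 1) ^ Suc n) * power_sum ?M (Suc n) =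
      (\<Sum>v\<le>m. c ((\<zeta> - 1) ^ Suc n) * ?T (Suc v))"
    by (simp add: sum_distrib_left)
  also have "\<dots> = (\<Sum>v\<le>m. c (of_nat k ^ Suc n * of_nat (fact (Suc n + m))) * (\<Prod>l<Suc n. x l) *
      (c (part_coeff v) * x n ^ v * ?E (m - v) n))"
  proof (intro sum.cong refl)
    fix v assume "v \<in> {..m}"
    then have v: "v \<le> m" by simp
    have nz: "of_nat (fact (Suc v)) \<noteq> (0::'k)" "of_nat (fact (n + (m - v))) \<noteq> (0::'k)"
      by (rule of_nat_fact_nonzero_mono[OF Suc.prems], use v in simp)+
    have "fact (Suc v) * fact (n + (m - v)) * (?M choose Suc v) = fact (Suc n + m)"
      using binomial_fact_lemma[of "Suc v" ?M] v by (simp add: add.commute del: fact_Suc)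
    then have "of_nat (fact (Suc v)) * of_nat (fact (n + (m - v))) * of_nat (?M choose Suc v) =
        (of_nat (fact (Suc n + m)) :: 'k)"
      by (metis of_nat_mult)
    \<comment> \<open>Opaque scalars stand for the factorials, which must not be unfolded here.\<close>
    moreover have regroup: "e * s * z * (K' * b) = K * K' * d * (s * z / (K * a))"
      if "a \<noteq> 0" "K \<noteq> 0" "a * b * e = d" for a b d e s z K K' :: 'k
      using that by (auto simp: field_simps)
    ultimately have coeff: "of_nat (?M choose Suc v) * coeff_a k \<zeta> (Suc v) * (\<zeta> - 1) *
          (of_nat k ^ n * of_nat (fact (n + (m - v)))) =
        of_nat k ^ Suc n * of_nat (fact (Suc n + m)) * part_coeff v"
      using regroup[OF nz(1) k_nonzero, of _ _ _ "coeff_a k \<zeta> (Suc v)" "\<zeta> - 1" "of_nat k ^ n"]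
      unfolding part_coeff_def Suc_eq_plus1[symmetric] power_Suc by blast
    have M: "?M - Suc v = (m - v) + n" using v by simp
    have "c ((\<zeta> - 1) ^ Suc n) * ?T (Suc v) =
        c (of_nat (?M choose Suc v) * coeff_a k \<zeta> (Suc v) * (\<zeta> - 1)) * x n ^ Suc v *
        (c ((\<zeta> - 1) ^ n) * power_sum ((m - v) + n) n)"
      unfolding M by (simp add: c_mult c_of_nat mult_ac del: binomial_Suc_Suc)
    also have "\<dots> = c (of_nat (?M choose Suc v) * coeff_a k \<zeta> (Suc v) * (\<zeta> - 1) *
          (of_nat k ^ n * of_nat (fact (n + (m - v))))) * x n ^ Suc v *
        (\<Prod>l<n. x l) * ?E (m - v) n"
      unfolding Suc.IH[OF nz(2)] by (simp add: c_mult mult_ac del: of_nat_fact)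
    also have "\<dots> = c (of_nat k ^ Suc n * of_nat (fact (Suc n + m))) * (\<Prod>l<Suc n. x l) *
        (c (part_coeff v) * x n ^ v * ?E (m - v) n)"
      unfolding coeff by (simp add: c_mult mult_ac del: of_nat_fact fact_Suc)
    finally show "c ((\<zeta> - 1) ^ Suc n) * ?T (Suc v) =
        c (of_nat k ^ Suc n * of_nat (fact (Suc n + m))) * (\<Prod>l<Suc n. x l) *
        (c (part_coeff v) * x n ^ v * ?E (m - v) n)" .
  qed
  also have "\<dots> = c (of_nat k ^ Suc n * of_nat (fact (Suc n + m))) * (\<Prod>l<Suc n. x l) *
      (\<Sum>v\<le>m. c (part_coeff v) * x n ^ v * ?E (m - v) n)"
    by (simp only: sum_distrib_left)
  also have "(\<Sum>v\<le>m. c (part_coeff v) * x n ^ v * ?E (m - v) n) = ?E m (Suc n)"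
    unfolding composition_sum_Suc atMost_atLeast0
    by (simp add: sum.atLeast_Suc_atMost part_coeff_0 c_1)
  finally show ?case .
qed

end

section \<open>The formula in the symmetric algebra\<close>

lemma coefficient_hom_poly_const: "coefficient_hom poly_const"
  by unfold_locales (fact poly_const_add poly_const_mult poly_const_1)+

theorem theorem2p9:
  fixes scale :: "'k::field \<Rightarrow> 'v::ab_group_add \<Rightarrow> 'v"
    and B :: "'v set"
    and P :: "'v \<Rightarrow> 'v"
    and q :: 'v
    and k :: nat
    and \<zeta> :: 'k
    and u :: "nat \<Rightarrow> 'v"
    and m n :: nat
  assumes "k \<ge> 2"
    and "finite_dimensional_vector_space scale B"
    and "Vector_Spaces.linear scale scale P"
    and "\<zeta> ^ k = 1" and "\<zeta> \<noteq> 1"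
    and "u 0 = 0"
    and "\<And>i j. j < k \<Longrightarrow> u (k * i + j) = P (u i) + scale (of_nat j) q"
    and "(of_nat k :: 'k) \<noteq> 0"
    and "(of_nat (fact (n + m)) :: 'k) \<noteq> 0"
    and "\<And>i. i < n \<Longrightarrow> (P ^^ i) q \<noteq> 0"
  shows "H_elem scale k \<zeta> P q u m n =
    (\<Oplus>\<^bsub>Sym scale\<^esub>\<nu>\<in>compositions m.
       sym_const scale
         (\<Prod>i<length \<nu>. coeff_a k \<zeta> (\<nu> ! i + 1) * (\<zeta> - 1) / (of_nat k * of_nat (fact (\<nu> ! i + 1))))
       \<otimes>\<^bsub>Sym scale\<^esub>
       (\<Oplus>\<^bsub>Sym scale\<^esub>l\<in>increasing_tuples (length \<nu>) n.
          \<Otimes>\<^bsub>Sym scale\<^esub>i\<in>{..<length \<nu>}.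
            sym_vec scale ((P ^^ (l ! i)) q) [^]\<^bsub>Sym scale\<^esub> (\<nu> ! i)))"
    (is "_ = ?rhs")
proof -
  obtain emb :: "(('v \<Rightarrow>\<^sub>0 nat) \<Rightarrow>\<^sub>0 'k) set \<Rightarrow> (nat \<Rightarrow>\<^sub>0 nat) \<Rightarrow>\<^sub>0 'k" and y
    where emb: "emb \<in> ring_hom (Sym scale) type_ring"
      and inj: "inj_on emb (carrier (Sym scale))"
      and emb_const: "\<And>a. emb (sym_const scale a) = poly_const a"
      and emb_vec: "\<And>v. emb (sym_vec scale v) = y v"
      and y_add: "\<And>v w. y (v + w) = y v + y w"
      and y_scale: "\<And>a v. y (scale a v) = poly_const a * y v"
      and y_inj: "\<And>v. y v = 0 \<Longrightarrow> v = 0"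
    by (rule Sym_embeds_into_polynomials[OF assms(2)]) blast
  define x where "x l = y ((P ^^ l) q)" for l
  interpret coefficient_hom "poly_const :: 'k \<Rightarrow> (nat \<Rightarrow>\<^sub>0 nat) \<Rightarrow>\<^sub>0 'k"
    by (rule coefficient_hom_poly_const)
  have y_0: "y 0 = 0"
    using y_add[of 0 0] by (metis add_0_left add_cancel_right_right)
  interpret seq: digit_sequence poly_const k \<zeta> "\<lambda>i. y (u i)" x
  proof
    fix i j n :: nat
    assume "i < k ^ n" "j < k"
    then show "y (u (i + j * k ^ n)) = y (u i) + of_nat j * x n"
      using digit_recursion_top_digit[OF assms(1,3,6,7)] by (simp add: y_add y_scale x_def c_of_nat)
  qed (use assms(1,4,5,6,8) y_0 in simp_all)

  interpret S: cring "Sym scale" by (rule cring_Sym)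
  interpret h: ring_hom_cring "Sym scale" type_ring emb
    by (intro ring_hom_cring.intro ring_hom_cring_axioms.intro S.cring_axioms
        cring_from_type_algebra emb)
  have emb_mult: "emb (s \<otimes>\<^bsub>Sym scale\<^esub> t) = emb s * emb t"
    if "s \<in> carrier (Sym scale)" "t \<in> carrier (Sym scale)" for s t
    using ring_hom_mult[OF emb that] by (simp add: type_ring_simps)
  have emb_pow: "emb (s [^]\<^bsub>Sym scale\<^esub> (e::nat)) = emb s ^ e"
    if "s \<in> carrier (Sym scale)" for s e
    using h.hom_pow[OF that] by (simp add: type_ring_pow)
  have emb_sum: "emb (\<Oplus>\<^bsub>Sym scale\<^esub>i\<in>I. f i) = (\<Sum>i\<in>I. emb (f i))"
    if "\<And>i. f i \<in> carrier (Sym scale)" for f :: "'i \<Rightarrow> _" and I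
    using h.hom_finsum[of f I] that by (simp add: type_ring_finsum o_def)
  have emb_prod: "emb (\<Otimes>\<^bsub>Sym scale\<^esub>i\<in>I. f i) = (\<Prod>i\<in>I. emb (f i))"
    if "\<And>i. f i \<in> carrier (Sym scale)" for f :: "'i \<Rightarrow> _" and I
    using h.hom_finprod[of f I] that by (simp add: type_ring_finprod o_def)
  note closed = sym_const_closed sym_vec_closed
  note emb_simps = emb_mult emb_pow emb_sum emb_prod emb_const emb_vec closed
    type_ring_finsum type_ring_finprod type_ring_pow type_ring_simps(2) o_def

  define D where "D = (\<Otimes>\<^bsub>Sym scale\<^esub>i\<in>{..<n}. sym_vec scale ((P ^^ i) q))"
  define G where "G = sym_const scale ((\<zeta> - 1) ^ n / (of_nat k ^ n * of_nat (fact (n + m))))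
    \<otimes>\<^bsub>Sym scale\<^esub> F_elem scale k \<zeta> u (m + n) n"
  have rhs_closed: "?rhs \<in> carrier (Sym scale)" and D_closed: "D \<in> carrier (Sym scale)"
    and F_closed: "F_elem scale k \<zeta> u (m + n) n \<in> carrier (Sym scale)"
    unfolding D_def F_elem_def
    by (intro S.finsum_closed S.finprod_closed S.m_closed S.nat_pow_closed Pi_I closed)+
  then have G_closed: "G \<in> carrier (Sym scale)"
    unfolding G_def by (intro S.m_closed closed)

  have emb_D: "emb D = (\<Prod>l<n. x l)"
    by (simp add: D_def emb_simps x_def)
  have emb_F: "emb (F_elem scale k \<zeta> u (m + n) n) = seq.power_sum (m + n) n"
    by (simp add: F_elem_def seq.power_sum_def emb_simps)
  have emb_rhs: "emb ?rhs = composition_sum (\<lambda>v l. poly_const (seq.part_coeff v) * x l ^ v) m n"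
    by (simp add: composition_sum_iterated emb_simps seq.part_coeff_def x_def c_prod prod.distrib
        sum_distrib_left del: of_nat_fact fact_Suc)

  \<comment> \<open>The identity in the polynomial ring, divided by \<open>?K\<close>, pulls back along the embedding.\<close>
  let ?K = "of_nat k ^ n * of_nat (fact (n + m)) :: 'k"
  let ?E = "composition_sum (\<lambda>v l. poly_const (seq.part_coeff v) * x l ^ v) m n"
  have "?K \<noteq> 0" using assms(8,9) by simp
  then have K_inverse: "poly_const (1 / ?K) * poly_const ?K = (1 :: (nat \<Rightarrow>\<^sub>0 nat) \<Rightarrow>\<^sub>0 'k)"
    by (simp only: c_mult[symmetric] c_1 nonzero_divide_eq_eq[symmetric] divide_self_if
        times_divide_eq_left mult_1_left if_False)
  have "emb G = poly_const ((\<zeta> - 1) ^ n / ?K) * seq.power_sum (m + n) n"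
    unfolding G_def by (simp only: emb_mult[OF sym_const_closed F_closed] emb_const emb_F)
  also have "\<dots> = poly_const (1 / ?K) * (poly_const ((\<zeta> - 1) ^ n) * seq.power_sum (m + n) n)"
    by (simp add: c_mult[symmetric] mult.assoc[symmetric] del: of_nat_fact)
  also have "\<dots> = (poly_const (1 / ?K) * poly_const ?K) * (\<Prod>l<n. x l) * ?E"
    unfolding seq.power_sum_factorization[OF assms(9)] by (simp only: mult.assoc)
  finally have "emb (D \<otimes>\<^bsub>Sym scale\<^esub> ?rhs) = emb G"
    by (simp only: K_inverse mult_1_left emb_mult[OF D_closed rhs_closed] emb_D emb_rhs)
  then have rhs_quotient: "D \<otimes>\<^bsub>Sym scale\<^esub> ?rhs = G"
    by (rule inj_onD[OF inj _ S.m_closed[OF D_closed rhs_closed] G_closed])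

  have "emb D \<noteq> 0"
    using assms(10) y_inj by (auto simp: emb_D x_def)
  then have rhs_unique: "h = ?rhs" if "h \<in> carrier (Sym scale)" "D \<otimes>\<^bsub>Sym scale\<^esub> h = G" for h
  proof -
    have "emb D * emb h = emb D * emb ?rhs"
      unfolding emb_mult[OF D_closed that(1), symmetric] emb_mult[OF D_closed rhs_closed, symmetric]
        that(2) rhs_quotient ..
    then have "emb h = emb ?rhs" by (rule mult_left_cancel[OF \<open>emb D \<noteq> 0\<close>, THEN iffD1])
    then show ?thesis by (rule inj_onD[OF inj _ that(1) rhs_closed])
  qed
  show ?thesis
    unfolding H_elem_def D_def[symmetric] G_def[symmetric]
    by (rule the_equality, rule conjI[OF rhs_closed rhs_quotient], erule conjE, rule rhs_unique)
qed

end
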